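(* Every chip configuration $\sigma$ on $K_n$ with $n^2-n<|\sigma|<n^2$ has eventual period $2$, where $|\sigma|=\sum_{v=1}^n\sigma(v)$.
   Context: Parallel chip-firing on $K_n$: a chip configuration is $\sigma:[n]\to\mathbb{Z}_{\ge0}$; let $r(\sigma)=\#\{v:\sigma(v)\ge n\}$ and $U\sigma(v)=\sigma(v)+r(\sigma)$ if $\sigma(v)\le n-1$, $U\sigma(v)=\sigma(v)-n+r(\sigma)$ if $\sigma(v)\ge n$. The eventual period of $\sigma$ is the least $m\ge1$ such that $U^{t+m}\sigma=U^t\sigma$ for all sufficiently large $t$. *)

theory Defs
  imports "HOL-Library.FuncSet"
begin

text \<open>
  A configuration on $K_n$ is an extensional function on \<open>{1..n}\<close> (fixed to \<open>undefined\<close>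
  elsewhere), so that HOL equality of configurations is equality on the vertex set.
\<close>

definition chip_configs :: "nat \<Rightarrow> (nat \<Rightarrow> nat) set" where
  "chip_configs n = {1..n} \<rightarrow>\<^sub>E UNIV"

definition num_chips :: "nat \<Rightarrow> (nat \<Rightarrow> nat) \<Rightarrow> nat" where
  "num_chips n \<sigma> = (\<Sum>v=1..n. \<sigma> v)"

definition num_firing :: "nat \<Rightarrow> (nat \<Rightarrow> nat) \<Rightarrow> nat" where
  "num_firing n \<sigma> = card {v \<in> {1..n}. \<sigma> v \<ge> n}"

definition chip_update :: "nat \<Rightarrow> (nat \<Rightarrow> nat) \<Rightarrow> nat \<Rightarrow> nat" where
  "chip_update n \<sigma> = (\<lambda>v\<in>{1..n}.
     if \<sigma> v \<ge> n then \<sigma> v - n + num_firing n \<sigma> else \<sigma> v + num_firing n \<sigma>)"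

definition eventual_period :: "nat \<Rightarrow> (nat \<Rightarrow> nat) \<Rightarrow> nat" where
  "eventual_period n \<sigma> = (LEAST m. m \<ge> 1 \<and>
     (\<forall>\<^sub>F t in sequentially. (chip_update n ^^ (t + m)) \<sigma> = (chip_update n ^^ t) \<sigma>))"

lemma chip_update_in_configs: "chip_update n \<sigma> \<in> chip_configs n"
  by (auto simp: chip_update_def chip_configs_def)

lemma num_chips_update: "num_chips n (chip_update n \<sigma>) = num_chips n \<sigma>"
proof -
  let ?r = "num_firing n \<sigma>"
  have fired: "(\<Sum>v=1..n. if \<sigma> v \<ge> n then n else 0) = n * ?r"
    by (simp add: sum.If_cases num_firing_def Int_def)
  have "num_chips n (chip_update n \<sigma>) + n * ?r
      = (\<Sum>v=1..n. chip_update n \<sigma> v + (if \<sigma> v \<ge> n then n else 0))"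
    by (simp only: sum.distrib fired num_chips_def)
  also have "\<dots> = (\<Sum>v=1..n. \<sigma> v + ?r)"
    by (rule sum.cong) (auto simp: chip_update_def)
  also have "\<dots> = num_chips n \<sigma> + n * ?r"
    by (simp add: sum.distrib num_chips_def)
  finally show ?thesis by simp
qed

text \<open>The \<open>LEAST\<close> in \<open>eventual_period\<close> ranges over a nonempty set.\<close>

lemma eventual_period_exists:
  assumes "\<sigma> \<in> chip_configs n"
  shows "\<exists>m\<ge>1. \<forall>\<^sub>F t in sequentially. (chip_update n ^^ (t + m)) \<sigma> = (chip_update n ^^ t) \<sigma>"
proof -
  let ?U = "chip_update n" and ?s = "num_chips n \<sigma>"
  let ?C = "{1..n} \<rightarrow>\<^sub>E {..?s}"
  have total: "num_chips n ((?U ^^ t) \<sigma>) = ?s" for t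
    by (induction t) (simp_all add: num_chips_update)
  have conf: "(?U ^^ t) \<sigma> \<in> {1..n} \<rightarrow>\<^sub>E UNIV" for t
    using assms chip_update_in_configs[of n] by (cases t) (auto simp: chip_configs_def)
  have le: "(?U ^^ t) \<sigma> v \<le> ?s" if "v \<in> {1..n}" for t v
    using member_le_sum[of v "{1..n}" "(?U ^^ t) \<sigma>"] that total[of t]
    by (simp add: num_chips_def)
  have "range (\<lambda>t. (?U ^^ t) \<sigma>) \<subseteq> ?C"
  proof
    fix \<tau> assume "\<tau> \<in> range (\<lambda>t. (?U ^^ t) \<sigma>)"
    then obtain t where t: "\<tau> = (?U ^^ t) \<sigma>" by blast
    show "\<tau> \<in> ?C" unfolding t using le[of _ t] conf[of t] unfolding PiE_iff by blast
  qed
  moreover have "finite ?C" by (simp add: finite_PiE)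
  ultimately have "\<not> inj (\<lambda>t. (?U ^^ t) \<sigma>)"
    using finite_imageD finite_subset infinite_UNIV_nat by blast
  then obtain a b where "a \<noteq> b" "(?U ^^ a) \<sigma> = (?U ^^ b) \<sigma>"
    by (auto simp: inj_def)
  then obtain a b where ab: "a < b" "(?U ^^ b) \<sigma> = (?U ^^ a) \<sigma>"
    by (metis linorder_neqE_nat)
  have "(?U ^^ (t + (b - a))) \<sigma> = (?U ^^ t) \<sigma>" if "t \<ge> a" for t
  proof -
    have "t + (b - a) = (t - a) + b" "t = (t - a) + a" using ab that by auto
    then show ?thesis using ab(2) by (metis funpow_add comp_apply)
  qed
  then show ?thesis
    using ab(1) by (intro exI[of _ "b - a"]) (auto simp: eventually_sequentially)
qed

end

theory Submission
  imports Defs Complex_Main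
begin

text \<open>
  Once every vertex holds fewer than $2n$ chips, a vertex $v$ has fired exactly
  $\lfloor(\sigma(v)+k)/n\rfloor$ times after the step following $k$ firings in total, so the total
  number of firings evolves by iterating the monotone map
  $f(k)=\sum_v\lfloor(\sigma(v)+k)/n\rfloor$, which satisfies $f(k+n)=f(k)+n$. By Hermite's identity
  $\sum_{0\le k<n} f(k)=|\sigma|$. If $f(f(x))>x+n$ for all $x$, comparing $f$ with its generalized
  inverse $g$ and using the Young-type identity $\sum f(k)+\sum g(k+1)=n^2$ gives $|\sigma|\ge n^2$;
  dually, $f(f(x))<x+n$ for all $x$ gives $|\sigma|\le n^2-n$. Hence orbits of $f\circ f-n$ are bounded,
  and, being monotone, they become constant: every two steps each vertex fires exactly once.
  A fixed configuration would have all or no vertices firing, which the bounds on $|\sigma|$ exclude.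
\<close>

section \<open>Monotone integer maps of degree one\<close>

text \<open>By monotonicity the whole orbit moves in the direction of its first step. Without a
  fixed point each step covers a distance of at least 1, so the orbit would leave the interval from
  \<open>L\<close> to \<open>M\<close>.\<close>

lemma mono_bounded_orbit_reaches_fixpoint:
  fixes h :: "int \<Rightarrow> int"
  assumes "mono h" and bnd: "\<And>i. L \<le> (h ^^ i) a" "\<And>i. (h ^^ i) a \<le> M"
  obtains i where "h ((h ^^ i) a) = (h ^^ i) a"
proof (rule ccontr)
  assume "\<not> thesis"
  with that have ne: "h ((h ^^ i) a) \<noteq> (h ^^ i) a" for i by blast
  consider "a \<le> h a" | "h a \<le> a" by linarith
  then show False
  proof cases
    case 1
    have "(h ^^ i) a \<le> h ((h ^^ i) a)" for i
      using 1 \<open>mono h\<close> by (induction i) (auto dest: monoD)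
    with ne have lt: "(h ^^ i) a < (h ^^ Suc i) a" for i
      by (simp add: order.not_eq_order_implies_strict[OF ne[symmetric]])
    have "a + int i \<le> (h ^^ i) a" for i
    proof (induction i)
      case (Suc i)
      with lt[of i] show ?case by simp
    qed simp
    from this[of "nat (M - a + 1)"] bnd(2)[of "nat (M - a + 1)"] bnd(2)[of 0] show False
      by simp
  next
    case 2
    have "h ((h ^^ i) a) \<le> (h ^^ i) a" for i
      using 2 \<open>mono h\<close> by (induction i) (auto dest: monoD)
    with ne have lt: "(h ^^ Suc i) a < (h ^^ i) a" for i
      by (simp add: order.not_eq_order_implies_strict)
    have "(h ^^ i) a \<le> a - int i" for i
    proof (induction i)
      case (Suc i)
      with lt[of i] show ?case by simp
    qed simp
    from this[of "nat (a - L + 1)"] bnd(1)[of "nat (a - L + 1)"] bnd(1)[of 0] show False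
      by simp
  qed
qed

lemma shift_multiple:
  fixes f :: "int \<Rightarrow> int"
  assumes "\<And>x. f (x + p) = f x + p"
  shows "f (x + m * p) = f x + m * p"
proof (induction m rule: int_induct[where k = 0])
  case (step1 i)
  then show ?case using assms[of "x + i * p"] by (simp add: algebra_simps)
next
  case (step2 i)
  then show ?case using assms[of "x + (i - 1) * p"] by (simp add: algebra_simps)
qed simp

text \<open>Sliding the window by one trades \<open>f a\<close> for
  \<open>f (a + p) = f a + p\<close>, a gain of \<open>p\<close>. Induction in both directions
  covers negative \<open>a\<close>.\<close>

lemma sum_over_period:
  fixes f :: "int \<Rightarrow> int"
  assumes "\<And>x. f (x + p) = f x + p" and "0 < p"
  shows "(\<Sum>k\<in>{a..<a + p}. f k) = (\<Sum>k\<in>{0..<p}. f k) + a * p"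
proof -
  have step: "(\<Sum>k\<in>{a + 1..<a + 1 + p}. f k) = (\<Sum>k\<in>{a..<a + p}. f k) + p" for a
  proof -
    have "{a..<a + p} = insert a {a + 1..<a + p}" "{a + 1..<a + 1 + p} = insert (a + p) {a + 1..<a + p}"
      using \<open>0 < p\<close> by auto
    then show ?thesis using assms(1)[of a] by simp
  qed
  show ?thesis
  proof (induction a rule: int_induct[where k = 0])
    case (step1 i)
    then show ?case using step[of i] by (simp add: algebra_simps)
  next
    case (step2 i)
    then show ?case using step[of "i - 1"] by (simp add: algebra_simps)
  qed simp
qed

section \<open>Generalized inverses and second iterates\<close>

locale degree_one_map =
  fixes f :: "int \<Rightarrow> int" and p :: int
  assumes f_mono: "mono f" and f_shift: "f (x + p) = f x + p" and p_pos: "0 < p"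
begin

text \<open>The shift law makes \<open>f\<close> unbounded in both directions, so by monotonicity
  the \<open>k\<close> with \<open>j <= f k\<close> form a nonempty up-set bounded below;
  \<open>g j\<close> is its minimum.\<close>

lemma generalized_inverse_exists: "\<exists>g. \<forall>k j. j \<le> f k \<longleftrightarrow> g j \<le> k"
proof (rule choice[of "\<lambda>j g. \<forall>k. j \<le> f k \<longleftrightarrow> g \<le> k", THEN exE])
  show "\<forall>j. \<exists>g. \<forall>k. j \<le> f k \<longleftrightarrow> g \<le> k"
  proof
    fix j
    \<comment> \<open>Chosen so that
      \<open>f (- (m * p)) = f 0 - m * p < j <= f 0 + m * p = f (m * p)\<close>.\<close>
    define m where "m = \<bar>f 0\<bar> + \<bar>j\<bar> + 1"
    have mp: "m \<le> m * p" using mult_left_mono[of 1 p m] p_pos by (simp add: m_def)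
    define l where "l = - (m * p)"
    have l: "f l < j"
      using shift_multiple[of f p 0 "- m", OF f_shift, simplified] mp m_def unfolding l_def by linarith
    have "j \<le> f (m * p)"
      using shift_multiple[of f p 0 m, OF f_shift, simplified] mp m_def by linarith
    moreover have "l + int (nat (m * p - l)) = m * p"
      using mp m_def unfolding l_def by linarith
    ultimately have ex: "\<exists>i::nat. j \<le> f (l + int i)" by metis
    define i where "i = (LEAST i::nat. j \<le> f (l + int i))"
    have i: "j \<le> f (l + int i)" unfolding i_def by (rule LeastI_ex[OF ex])
    have "j \<le> f k \<longleftrightarrow> l + int i \<le> k" for k
    proof
      assume "l + int i \<le> k"
      then show "j \<le> f k" using i monoD[OF f_mono] by (metis order_trans)
    next
      assume k: "j \<le> f k"
      then have "l \<le> k" using l monoD[OF f_mono, of k l] by linarith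
      then have "j \<le> f (l + int (nat (k - l)))" using k by simp
      then have "i \<le> nat (k - l)" unfolding i_def by (rule Least_le)
      with \<open>l \<le> k\<close> show "l + int i \<le> k" by linarith
    qed
    then show "\<exists>g. \<forall>k. j \<le> f k \<longleftrightarrow> g \<le> k" by blast
  qed
qed blast

definition inv_f :: "int \<Rightarrow> int" where
  "inv_f = (SOME g. \<forall>k j. j \<le> f k \<longleftrightarrow> g j \<le> k)"

lemma le_f_iff: "j \<le> f k \<longleftrightarrow> inv_f j \<le> k"
  using someI_ex[OF generalized_inverse_exists] unfolding inv_f_def by blast

lemma inv_f_shift: "inv_f (j + p) = inv_f j + p"
proof -
  have "inv_f (j + p) \<le> k \<longleftrightarrow> inv_f j + p \<le> k" for k
    using le_f_iff[of "j + p" k] le_f_iff[of j "k - p"] f_shift[of "k - p"] by auto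
  then show ?thesis by (meson order_antisym order_refl)
qed

text \<open>Both sums count lattice points of a $p\times p$ square, on either side of the graph of \<^term>\<open>f\<close>.\<close>

lemma sum_f_plus_sum_inv_f:
  "(\<Sum>k\<in>{0..<p}. f k) + (\<Sum>j\<in>{0..<p}. inv_f (j + 1)) = p * p"
proof -
  \<comment> \<open>The square has columns \<open>0..<p\<close> and rows \<open>a..<a + p\<close>;
    starting at height \<open>f 0\<close> keeps the graph inside it, since
    \<open>f p = a + p\<close>.\<close>
  define a where "a = f 0"
  have card1: "f k - a = (\<Sum>j\<in>{a..<a + p}. of_bool (j + 1 \<le> f k))" if "k \<in> {0..<p}" for k
  proof -
    have "a \<le> f k" "f k \<le> a + p"
      using that monoD[OF f_mono, of 0 k] monoD[OF f_mono, of k p] f_shift[of 0] by (auto simp: a_def)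
    then have "{a..<a + p} \<inter> {j. j + 1 \<le> f k} = {a..<f k}" by auto
    then show ?thesis using \<open>a \<le> f k\<close> by (simp add: of_bool_def sum.If_cases)
  qed
  have card2: "(\<Sum>k\<in>{0..<p}. of_bool (j + 1 \<le> f k)) = p - inv_f (j + 1)" if "j \<in> {a..<a + p}" for j
  proof -
    have "inv_f (j + 1) \<le> p" using le_f_iff[of "j + 1" p] that f_shift[of 0] by (simp add: a_def)
    have "0 \<le> inv_f (j + 1)"
      using le_f_iff[of "j + 1" "-1"] that monoD[OF f_mono, of "-1" 0] by (auto simp: a_def)
    then have "{0..<p} \<inter> {k. j + 1 \<le> f k} = {inv_f (j + 1)..<p}" by (auto simp: le_f_iff)
    then show ?thesis using \<open>inv_f (j + 1) \<le> p\<close> by (simp add: of_bool_def sum.If_cases)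
  qed
  have "(\<Sum>k\<in>{0..<p}. f k) - p * a = (\<Sum>k\<in>{0..<p}. f k - a)"
    using p_pos by (simp add: sum_subtractf)
  also have "\<dots> = (\<Sum>k\<in>{0..<p}. \<Sum>j\<in>{a..<a + p}. of_bool (j + 1 \<le> f k))"
    by (rule sum.cong) (use card1 in auto)
  also have "\<dots> = (\<Sum>j\<in>{a..<a + p}. \<Sum>k\<in>{0..<p}. of_bool (j + 1 \<le> f k))"
    by (rule sum.swap)
  also have "\<dots> = (\<Sum>j\<in>{a..<a + p}. p - inv_f (j + 1))"
    by (rule sum.cong) (use card2 in auto)
  also have "\<dots> = p * p - (\<Sum>j\<in>{a..<a + p}. inv_f (j + 1))"
    using p_pos by (simp add: sum_subtractf)
  \<comment> \<open>Moving the rows back to \<open>0..<p\<close> produces \<open>a * p\<close>,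
    which cancels the \<open>p * a\<close> subtracted from the sum of \<open>f\<close>.\<close>
  also have "(\<Sum>j\<in>{a..<a + p}. inv_f (j + 1)) = (\<Sum>j\<in>{0..<p}. inv_f (j + 1)) + a * p"
    by (rule sum_over_period) (use p_pos inv_f_shift[of "_ + 1"] in \<open>simp_all add: ac_simps\<close>)
  finally show ?thesis by (simp add: algebra_simps)
qed

text \<open>Otherwise the adjunction gives \<open>inv_f (x + 1) + p <= f x\<close> for all
  \<open>x\<close>. With S the sum of \<open>f\<close> over a period, summing yields p^2 - S + p^2
  <= S, so S >= p^2.\<close>

lemma f_f_le_ex:
  assumes "(\<Sum>k\<in>{0..<p}. f k) < p * p"
  shows "\<exists>x. f (f x) \<le> x + p"
proof (rule ccontr)
  assume "\<nexists>x. f (f x) \<le> x + p"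
  then have "x + 1 + p \<le> f (f x)" for x by (metis add.commute add.left_commute not_le zless_imp_add1_zle)
  then have "inv_f (x + 1) + p \<le> f x" for x
    using le_f_iff inv_f_shift by metis
  then have "(\<Sum>k\<in>{0..<p}. inv_f (k + 1) + p) \<le> (\<Sum>k\<in>{0..<p}. f k)"
    by (intro sum_mono) auto
  then show False
    using assms sum_f_plus_sum_inv_f p_pos by (simp add: sum.distrib)
qed

text \<open>Dually, \<open>f x <= inv_f x + p - 1\<close> for all \<open>x\<close>. Summing over x =
  k + 1 costs \<open>p\<close> twice, once for integrality and once for the shift of the window: S +
  p <= p^2 - S + p (p - 1), so S <= p^2 - p.\<close>

lemma f_f_ge_ex:
  assumes "p * p - p < (\<Sum>k\<in>{0..<p}. f k)"
  shows "\<exists>x. x + p \<le> f (f x)"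
proof (rule ccontr)
  assume "\<nexists>x. x + p \<le> f (f x)"
  then have lt: "f x < inv_f x + p" for x
    using le_f_iff inv_f_shift by (metis not_le)
  have "(\<Sum>k\<in>{0..<p}. f (k + 1)) \<le> (\<Sum>k\<in>{0..<p}. inv_f (k + 1) + (p - 1))"
    by (rule sum_mono) (use lt in \<open>simp add: algebra_simps flip: zle_diff1_eq\<close>)
  also have "\<dots> = (\<Sum>k\<in>{0..<p}. inv_f (k + 1)) + p * (p - 1)"
    using p_pos by (simp add: sum.distrib)
  also have "(\<Sum>k\<in>{0..<p}. f (k + 1)) = (\<Sum>k\<in>{1..<1 + p}. f k)"
    by (rule sum.reindex_bij_witness[of _ "\<lambda>k. k - 1" "\<lambda>k. k + 1"]) auto
  also have "\<dots> = (\<Sum>k\<in>{0..<p}. f k) + p"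
    using sum_over_period[of f p 1, OF f_shift p_pos] by simp
  finally show False
    using assms sum_f_plus_sum_inv_f by (simp add: algebra_simps)
qed

text \<open>The map \<open>h\<close> is monotone and commutes with translation by \<open>p\<close>,
  so translates of \<open>x\<close> are barriers from above for its orbits and translates of
  \<open>y\<close> barriers from below.\<close>

lemma orbit_advances_by_p_in_two_steps:
  assumes x: "f (f x) \<le> x + p" and y: "y + p \<le> f (f y)"
  shows "\<exists>T. \<forall>t\<ge>T. (f ^^ (t + 2)) a = (f ^^ t) a + p"
proof -
  define h where "h = (\<lambda>z. f (f z) - p)"
  have h_mono: "mono h" using f_mono by (auto simp: h_def mono_def)
  have h_shift: "h (z + p) = h z + p" for z by (simp add: h_def f_shift)
  have f_iter_shift: "(f ^^ t) (z + p) = (f ^^ t) z + p" for t z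
    by (induction t) (simp_all add: f_shift)
  have h_f: "(f ^^ (2 * i)) a = (h ^^ i) a + int i * p" for i
  proof (induction i)
    case (Suc i)
    have "(f ^^ (2 * Suc i)) a = f (f ((h ^^ i) a + int i * p))" using Suc by simp
    also have "\<dots> = h ((h ^^ i) a) + p + int i * p"
      unfolding shift_multiple[of f p, OF f_shift] by (simp add: h_def)
    finally show ?case by (simp add: algebra_simps)
  qed simp
  \<comment> \<open>Large enough that \<open>a\<close> lies between \<open>y - m * p\<close> and
    \<open>x + m * p\<close>.\<close>
  define m where "m = \<bar>a\<bar> + \<bar>x\<bar> + \<bar>y\<bar>"
  have mp: "m \<le> m * p" using mult_left_mono[of 1 p m] p_pos by (simp add: m_def)
  have up: "(h ^^ i) a \<le> x + m * p" for i
  proof (induction i)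
    case 0
    show ?case using mp by (simp add: m_def)
  next
    case (Suc i)
    have "h ((h ^^ i) a) \<le> h (x + m * p)" using Suc h_mono by (rule monoD[rotated])
    also have "\<dots> = h x + m * p" by (rule shift_multiple[of h p, OF h_shift])
    also have "h x \<le> x" using x by (simp add: h_def)
    finally show ?case by simp
  qed
  have low: "y + (- m) * p \<le> (h ^^ i) a" for i
  proof (induction i)
    case 0
    show ?case unfolding funpow_0 mult_minus_left using mp m_def by linarith
  next
    case (Suc i)
    have "y \<le> h y" using y by (simp add: h_def)
    then have "y + (- m) * p \<le> h (y + (- m) * p)" by (simp only: shift_multiple[of h p, OF h_shift])
    also have "\<dots> \<le> h ((h ^^ i) a)" using Suc h_mono by (rule monoD[rotated])
    finally show ?case by simp
  qed
  obtain i where i: "h ((h ^^ i) a) = (h ^^ i) a"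
    using mono_bounded_orbit_reaches_fixpoint[OF h_mono low up] .
  have base: "(f ^^ (2 + 2 * i)) a = (f ^^ (2 * i)) a + p"
    using h_f[of i] h_f[of "Suc i"] i by (simp add: algebra_simps)
  \<comment> \<open>Iterates of \<open>f\<close> commute with the translation, so the relation at
    time \<open>2 * i\<close> passes to all later times of either parity.\<close>
  have "(f ^^ (t + 2)) a = (f ^^ t) a + p" if "t \<ge> 2 * i" for t
  proof -
    from that obtain s where s: "t = s + 2 * i" by (metis le_add_diff_inverse2)
    have "(f ^^ (t + 2)) a = (f ^^ (s + (2 + 2 * i))) a" by (simp only: s ac_simps)
    also have "\<dots> = (f ^^ s) ((f ^^ (2 + 2 * i)) a)" by (subst funpow_add) (rule comp_apply)
    also have "\<dots> = (f ^^ s) ((f ^^ (2 * i)) a) + p" by (simp only: base f_iter_shift)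
    also have "(f ^^ s) ((f ^^ (2 * i)) a) = (f ^^ t) a" by (simp only: s funpow_add comp_apply)
    finally show ?thesis .
  qed
  then show ?thesis by blast
qed

end

lemma hermite_identity:
  fixes x p :: int
  assumes "0 < p"
  shows "(\<Sum>k\<in>{0..<p}. (x + k) div p) = x"
proof -
  have eq: "(\<Sum>k\<in>{a..<a + p}. k div p) = a" for a
  proof -
    \<comment> \<open>The quotient grows by only 1 per period; the factor \<open>p\<close> turns
      this into the shift by \<open>p\<close> that \<open>sum_over_period\<close> needs.\<close>
    have "(\<Sum>k\<in>{a..<a + p}. k div p * p) = (\<Sum>k\<in>{0..<p}. k div p * p) + a * p"
      by (rule sum_over_period) (use assms in \<open>simp_all add: algebra_simps div_add_self2\<close>)
    also have "(\<Sum>k\<in>{0..<p}. k div p * p) = 0" by (rule sum.neutral) auto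
    finally show ?thesis using assms by (simp flip: sum_distrib_right)
  qed
  have "(\<Sum>k\<in>{0..<p}. (x + k) div p) = (\<Sum>k\<in>{x..<x + p}. k div p)"
    by (rule sum.reindex_bij_witness[of _ "\<lambda>k. k - x" "\<lambda>k. x + k"]) auto
  with eq show ?thesis by simp
qed

section \<open>Confined configurations\<close>

definition total_firings :: "nat \<Rightarrow> (nat \<Rightarrow> nat) \<Rightarrow> int \<Rightarrow> int" where
  "total_firings n \<sigma> k = (\<Sum>v=1..n. (int (\<sigma> v) + k) div int n)"

lemma degree_one_total_firings:
  assumes "0 < n"
  shows "degree_one_map (total_firings n \<sigma>) (int n)"
proof
  show "mono (total_firings n \<sigma>)"
    by (auto simp: mono_def total_firings_def intro!: sum_mono zdiv_mono1 assms)
  show "total_firings n \<sigma> (x + int n) = total_firings n \<sigma> x + int n" for x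
  proof -
    have "(int (\<sigma> v) + (x + int n)) div int n = (int (\<sigma> v) + x) div int n + 1" for v
      using assms by (simp flip: add.assoc)
    then show ?thesis by (simp add: total_firings_def sum.distrib)
  qed
qed (use assms in simp)

lemma sum_total_firings:
  assumes "0 < n"
  shows "(\<Sum>k\<in>{0..<int n}. total_firings n \<sigma> k) = int (num_chips n \<sigma>)"
  unfolding total_firings_def
  by (subst sum.swap) (use assms in \<open>simp add: hermite_identity num_chips_def\<close>)

lemma num_firing_le: "num_firing n \<sigma> \<le> n"
  proof -
  have "num_firing n \<sigma> \<le> card {1..n}" unfolding num_firing_def by (rule card_mono) auto
  then show ?thesis by simp
qed

lemma chip_update_confined:
  assumes "\<sigma> v < 2 * n" "v \<in> {1..n}"
  shows "chip_update n \<sigma> v < 2 * n"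
  using assms num_firing_le[of n \<sigma>] by (auto simp: chip_update_def)

lemma num_firing_confined:
  assumes "\<And>v. v \<in> {1..n} \<Longrightarrow> \<sigma> v < 2 * n"
  shows "int (num_firing n \<sigma>) = (\<Sum>v=1..n. int (\<sigma> v) div int n)"
proof -
  have "int (\<sigma> v) div int n = (if n \<le> \<sigma> v then 1 else 0)" if "v \<in> {1..n}" for v
    using assms[OF that]
    by (cases "n \<le> \<sigma> v") (simp_all add: div_pos_geq div_pos_pos_trivial)
  then have "(\<Sum>v=1..n. int (\<sigma> v) div int n) = (\<Sum>v=1..n. if n \<le> \<sigma> v then 1 else 0)"
    by (intro sum.cong) auto
  then show ?thesis by (simp add: num_firing_def sum.If_cases Int_def)
qed

text \<open>The configuration \<open>\<tau>\<close> is reached from \<open>\<sigma>\<close> when vertex \<open>v\<close> has fired \<open>u v\<close> times.\<close>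

lemma chip_update_from_firing_counts:
  assumes conf: "\<And>v. v \<in> {1..n} \<Longrightarrow> \<tau> v < 2 * n"
    and \<tau>: "\<And>v. v \<in> {1..n} \<Longrightarrow> int (\<tau> v) = int (\<sigma> v) + (\<Sum>w=1..n. u w) - int n * u v"
    and v: "v \<in> {1..n}"
  shows "int (chip_update n \<tau> v) = int (\<sigma> v) + total_firings n \<sigma> (\<Sum>w=1..n. u w)
    - int n * ((int (\<sigma> v) + (\<Sum>w=1..n. u w)) div int n)"
proof -
  define k where "k = (\<Sum>w=1..n. u w)"
  \<comment> \<open>For confined \<open>\<tau>\<close> the last quotient is 1 if \<open>w\<close>
    fires and 0 otherwise, so the left side is the firing count after the next step.\<close>
  have d: "(int (\<sigma> w) + k) div int n = u w + int (\<tau> w) div int n" if "w \<in> {1..n}" for w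
  proof -
    have "int (\<sigma> w) + k = int (\<tau> w) + u w * int n" using \<tau>[OF that] by (simp add: k_def)
    then show ?thesis using v by simp
  qed
  have "total_firings n \<sigma> k = (\<Sum>w=1..n. u w + int (\<tau> w) div int n)"
    unfolding total_firings_def by (rule sum.cong) (rule refl, rule d)
  also have "\<dots> = k + (\<Sum>w=1..n. int (\<tau> w) div int n)"
    unfolding k_def by (rule sum.distrib)
  also have "(\<Sum>w=1..n. int (\<tau> w) div int n) = int (num_firing n \<tau>)"
    using conf by (rule num_firing_confined[symmetric])
  finally have "total_firings n \<sigma> k = k + int (num_firing n \<tau>)" .
  moreover have "int (\<tau> v) = int (\<sigma> v) + k - int n * u v" using \<tau>[OF v] by (simp add: k_def)
  moreover have "int (\<tau> v) div int n = (if n \<le> \<tau> v then 1 else 0)"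
    using conf[OF v] by (cases "n \<le> \<tau> v") (simp_all add: div_pos_geq div_pos_pos_trivial)
  then have "int (chip_update n \<tau> v)
      = int (\<tau> v) + int (num_firing n \<tau>) - int n * (int (\<tau> v) div int n)"
    using v by (simp add: chip_update_def)
  ultimately show ?thesis
    unfolding k_def[symmetric] d[OF v] distrib_left by linarith
qed

text \<open>Here \<open>k t\<close> counts all firings in the first \<open>t\<close> steps. The
  firing count of \<open>v\<close> after \<open>Suc t\<close> steps is read off from the preceding
  total \<open>k t\<close>, hence the offset between the two terms.\<close>

lemma chip_update_iterate_confined:
  assumes conf: "\<And>v. v \<in> {1..n} \<Longrightarrow> \<sigma> v < 2 * n" and "v \<in> {1..n}"
  defines "k \<equiv> (\<lambda>t. (total_firings n \<sigma> ^^ t) 0)"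
  shows "int ((chip_update n ^^ Suc t) \<sigma> v)
    = int (\<sigma> v) + k (Suc t) - int n * ((int (\<sigma> v) + k t) div int n)"
  using \<open>v \<in> {1..n}\<close>
proof (induction t arbitrary: v)
  case 0
  then show ?case
    using chip_update_from_firing_counts[where \<tau> = \<sigma> and \<sigma> = \<sigma> and u = "\<lambda>_. 0", OF conf]
    by (simp add: k_def)
next
  case (Suc t)
  have conf_iter: "(chip_update n ^^ i) \<sigma> w < 2 * n" if "w \<in> {1..n}" for i w
    using that by (induction i) (simp_all add: conf chip_update_confined)
  define u where "u w = (int (\<sigma> w) + k t) div int n" for w
  have k_Suc: "k (Suc i) = total_firings n \<sigma> (k i)" for i by (simp add: k_def)
  have sum_u: "(\<Sum>w=1..n. u w) = k (Suc t)"
    unfolding k_Suc total_firings_def u_def ..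
  have "int ((chip_update n ^^ Suc t) \<sigma> w) = int (\<sigma> w) + (\<Sum>w=1..n. u w) - int n * u w"
    if "w \<in> {1..n}" for w
    unfolding sum_u unfolding u_def by (rule Suc.IH[OF that])
  from chip_update_from_firing_counts[OF conf_iter this Suc.prems] show ?case
    unfolding sum_u k_Suc[of "Suc t"] by simp
qed

lemma chip_configs_eqI:
  assumes "\<sigma> \<in> chip_configs n" "\<tau> \<in> chip_configs n" "\<And>v. v \<in> {1..n} \<Longrightarrow> \<sigma> v = \<tau> v"
  shows "\<sigma> = \<tau>"
  using assms unfolding chip_configs_def by (rule PiE_ext)

lemma confined_eventually_two_periodic:
  assumes conf: "\<And>v. v \<in> {1..n} \<Longrightarrow> \<sigma> v < 2 * n"
    and lower: "n\<^sup>2 - n < num_chips n \<sigma>" and upper: "num_chips n \<sigma> < n\<^sup>2"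
  shows "\<forall>\<^sub>F t in sequentially. (chip_update n ^^ (t + 2)) \<sigma> = (chip_update n ^^ t) \<sigma>"
proof -
  have n: "0 < n" using upper by (cases n) auto
  interpret degree_one_map "total_firings n \<sigma>" "int n"
    by (rule degree_one_total_firings[OF n])
  have "int (n\<^sup>2 - n) = int n * int n - int n"
    by (simp add: of_nat_diff power2_eq_square)
  then have "int n * int n - int n < int (num_chips n \<sigma>)" using lower by linarith
  moreover have "int (num_chips n \<sigma>) < int n * int n"
    using upper by (metis of_nat_less_iff of_nat_mult power2_eq_square)
  ultimately obtain T where
    T: "\<And>t. t \<ge> T \<Longrightarrow> (total_firings n \<sigma> ^^ (t + 2)) 0 = (total_firings n \<sigma> ^^ t) 0 + int n"
    using f_f_le_ex f_f_ge_ex orbit_advances_by_p_in_two_steps sum_total_firings[OF n, of \<sigma>] by metis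
  have "(chip_update n ^^ (Suc t + 2)) \<sigma> = (chip_update n ^^ Suc t) \<sigma>" if "t \<ge> T" for t
  proof (rule chip_configs_eqI)
    fix v assume v: "v \<in> {1..n}"
    define k where "k = (\<lambda>t. (total_firings n \<sigma> ^^ t) 0)"
    \<comment> \<open>In two steps \<open>v\<close> receives \<open>n\<close> chips in all and fires
      exactly once, so gain and loss cancel.\<close>
    have "(int (\<sigma> v) + (k t + int n)) div int n = (int (\<sigma> v) + k t) div int n + 1"
      using n by (simp flip: add.assoc)
    moreover have "k (t + 2) = k t + int n" "k (Suc (t + 2)) = k (Suc t) + int n"
      using T[of t] T[of "Suc t"] that by (simp_all add: k_def)
    moreover have iter: "int ((chip_update n ^^ Suc i) \<sigma> v)
        = int (\<sigma> v) + k (Suc i) - int n * ((int (\<sigma> v) + k i) div int n)" for i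
      unfolding k_def using conf v by (rule chip_update_iterate_confined)
    ultimately have "int ((chip_update n ^^ Suc (t + 2)) \<sigma> v) = int ((chip_update n ^^ Suc t) \<sigma> v)"
      unfolding iter by (simp add: algebra_simps)
    then show "(chip_update n ^^ (Suc t + 2)) \<sigma> v = (chip_update n ^^ Suc t) \<sigma> v" by simp
  qed (simp_all add: chip_update_in_configs)
  then have "(chip_update n ^^ (t + 2)) \<sigma> = (chip_update n ^^ t) \<sigma>" if "t \<ge> Suc T" for t
    using that by (cases t) auto
  then show ?thesis by (auto simp: eventually_sequentially)
qed

section \<open>Reaching a confined configuration\<close>

lemma num_firing_less:
  assumes "num_chips n \<sigma> < n\<^sup>2"
  shows "num_firing n \<sigma> < n"
proof (rule ccontr)
  assume "\<not> num_firing n \<sigma> < n"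
  then have "card {v \<in> {1..n}. \<sigma> v \<ge> n} = card {1..n}"
    using num_firing_le[of n \<sigma>] by (simp add: num_firing_def)
  then have "{v \<in> {1..n}. \<sigma> v \<ge> n} = {1..n}" by (intro card_subset_eq) auto
  then have "(\<Sum>v=1..n. n) \<le> num_chips n \<sigma>"
    unfolding num_chips_def by (intro sum_mono) blast
  with assms show False by (simp add: power2_eq_square)
qed

lemma num_firing_pos:
  assumes "n\<^sup>2 - n < num_chips n \<sigma>"
  shows "0 < num_firing n \<sigma>"
proof (rule ccontr)
  assume "\<not> 0 < num_firing n \<sigma>"
  then have "\<sigma> v \<le> n - 1" if "v \<in> {1..n}" for v
    using that by (fastforce simp: num_firing_def)
  then have "num_chips n \<sigma> \<le> (\<Sum>v=1..n. n - 1)"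
    unfolding num_chips_def by (intro sum_mono) auto
  with assms show False by (simp add: power2_eq_square diff_mult_distrib2)
qed

lemma num_chips_iterate: "num_chips n ((chip_update n ^^ t) \<sigma>) = num_chips n \<sigma>"
  by (induction t) (simp_all add: num_chips_update)

text \<open>Fewer than \<open>n\<close> vertices fire at each step, so a firing vertex loses at
  least one chip net, while a vertex that does not fire ends with at most
  \<open>2 * n - 2\<close>.\<close>

lemma chip_update_iterate_le:
  assumes "num_chips n \<sigma> < n\<^sup>2" "v \<in> {1..n}"
  shows "(chip_update n ^^ t) \<sigma> v \<le> max (2 * n - 1) (\<sigma> v - t)"
proof (induction t)
  case (Suc t)
  let ?\<tau> = "(chip_update n ^^ t) \<sigma>"
  have "num_firing n ?\<tau> < n" using assms(1) by (intro num_firing_less) (simp add: num_chips_iterate)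
  then have "chip_update n ?\<tau> v \<le> max (2 * n - 1) (?\<tau> v - 1)"
    using assms(2) by (auto simp: chip_update_def)
  with Suc show ?case by auto
qed simp

section \<open>Absence of fixed configurations and the exact period\<close>

lemma chip_update_neq:
  assumes "n\<^sup>2 - n < num_chips n \<sigma>" "num_chips n \<sigma> < n\<^sup>2"
  shows "chip_update n \<sigma> \<noteq> \<sigma>"
proof
  assume eq: "chip_update n \<sigma> = \<sigma>"
  have r: "0 < num_firing n \<sigma>" "num_firing n \<sigma> < n"
    using assms num_firing_pos num_firing_less by auto
  \<comment> \<open>Any vertex would do: its content changes by r or by r - n, where 0 < r < n is
    the number of firing vertices.\<close>
  then have "1 \<in> {1..n}" by auto
  then have "chip_update n \<sigma> 1 \<noteq> \<sigma> 1" using r by (auto simp: chip_update_def)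
  with eq show False by simp
qed

theorem theorem4p13:
  fixes n :: nat and \<sigma> :: "nat \<Rightarrow> nat"
  assumes "\<sigma> \<in> chip_configs n"
    and "n\<^sup>2 - n < num_chips n \<sigma>"
    and "num_chips n \<sigma> < n\<^sup>2"
  shows "eventual_period n \<sigma> = 2"
proof -
  \<comment> \<open>A waiting time that serves all vertices: \<open>\<sigma> v <= s\<close>, so
    after \<open>s\<close> steps the truncated difference \<open>\<sigma> v - s\<close> is
    0.\<close>
  define s where "s = num_chips n \<sigma>"
  have n: "0 < n" using assms(3) by (cases n) auto
  have "(chip_update n ^^ s) \<sigma> v < 2 * n" if "v \<in> {1..n}" for v
  proof -
    have "\<sigma> v \<le> s" unfolding s_def num_chips_def using that by (intro member_le_sum) auto
    then show ?thesis using chip_update_iterate_le[OF assms(3) that, of s] n by auto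
  qed
  then have "\<forall>\<^sub>F t in sequentially. (chip_update n ^^ (t + 2)) ((chip_update n ^^ s) \<sigma>)
      = (chip_update n ^^ t) ((chip_update n ^^ s) \<sigma>)"
    using assms(2,3) by (intro confined_eventually_two_periodic) (simp_all add: num_chips_iterate)
  then have "\<forall>\<^sub>F t in sequentially. (chip_update n ^^ (t + s + 2)) \<sigma> = (chip_update n ^^ (t + s)) \<sigma>"
    by (simp add: funpow_add add.commute add.left_commute)
  then have two: "\<forall>\<^sub>F t in sequentially. (chip_update n ^^ (t + 2)) \<sigma> = (chip_update n ^^ t) \<sigma>"
    by (rule eventually_sequentially_seg[THEN iffD1])
  \<comment> \<open>Period 1 would make some iterate a fixed configuration, but every iterate has
    the same number of chips as \<open>\<sigma>\<close>.\<close>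
  have not_one: "\<not> (\<forall>\<^sub>F t in sequentially. (chip_update n ^^ (t + 1)) \<sigma> = (chip_update n ^^ t) \<sigma>)"
  proof
    assume "\<forall>\<^sub>F t in sequentially. (chip_update n ^^ (t + 1)) \<sigma> = (chip_update n ^^ t) \<sigma>"
    then obtain t where "(chip_update n ^^ (t + 1)) \<sigma> = (chip_update n ^^ t) \<sigma>"
      using eventually_happens' sequentially_bot by blast
    moreover have "chip_update n ((chip_update n ^^ t) \<sigma>) \<noteq> (chip_update n ^^ t) \<sigma>"
      using assms(2,3) by (intro chip_update_neq) (simp_all add: num_chips_iterate)
    ultimately show False by simp
  qed
  show ?thesis
    unfolding eventual_period_def
  proof (rule Least_equality)
    fix m assume m: "m \<ge> 1 \<and>
      (\<forall>\<^sub>F t in sequentially. (chip_update n ^^ (t + m)) \<sigma> = (chip_update n ^^ t) \<sigma>)"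
    then have "m \<noteq> 1" using not_one by blast
    with m show "2 \<le> m" by linarith
  qed (use two in simp)
qed

end
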